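(* Let $\mathbf{k}$ be a field of characteristic $0$, $\lambda\in\mathbf{k}$, and let $(\mathfrak{g},\mu=[\cdot,\cdot]_{\mathfrak{g}},K)$ be a modified Rota-Baxter Leibniz algebra of weight $\lambda$. If $H^2_{\mathrm{MLeib}}(\mathfrak{g})=0$, then $(\mathfrak{g},\mu,K)$ is rigid, i.e. every $1$-parameter formal deformation of $(\mathfrak{g},\mu,K)$ is trivial.
   Context: A (left) Leibniz algebra is a vector space (or module) with a bilinear bracket satisfying $[x,[y,z]]=[[x,y],z]+[y,[x,z]]$. A modified Rota-Baxter Leibniz algebra of weight $\lambda$ is a Leibniz algebra with a linear map $K$ satisfying $[K(x),K(y)]=K([K(x),y]+[x,K(y)])+\lambda[x,y]$. A $1$-parameter formal deformation of $(\mathfrak{g},\mu,K)$ is a pair $(\mu_t,K_t)$, $\mu_t=\sum_{i\ge0}\mu_it^i$, $K_t=\sum_{i\ge0}K_it^i$ with $\mu_i\in\mathrm{Hom}(\mathfrak{g}^{\otimes2},\mathfrak{g})$, $K_i\in\mathrm{Hom}(\mathfrak{g},\mathfrak{g})$, $(\mu_0,K_0)=(\mu,K)$, which (extended $\mathbf{k}[[t]]$-linearly) makes $\mathfrak{g}[[t]]$ a modified Rota-Baxter Leibniz algebra of weight $\lambda$ over $\mathbf{k}[[t]]$. Two deformations $(\mu_t,K_t)$, $(\mu'_t,K'_t)$ are equivalent if there is a formal isomorphism $\psi_t=\sum_{i\ge0}\psi_it^i:\mathfrak{g}[[t]]\to\mathfrak{g}[[t]]$, with $\psi_i:\mathfrak{g}\to\mathfrak{g}$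 linear and $\psi_0=\mathrm{id}_{\mathfrak{g}}$, such that $\psi_t\circ\mu'_t=\mu_t\circ(\psi_t\otimes\psi_t)$ and $\psi_t\circ K'_t=K_t\circ\psi_t$. A deformation is trivial if it is equivalent to the constant one ($\mu_t=\mu$, $K_t=K$). Cohomology with coefficients in the regular representation ($V=\mathfrak{g}$, $\rho^L(x)y=[x,y]$, $\rho^R(x)y=[y,x]$, $K_V=K$), in the degrees needed. Put $[x,y]_K=[K(x),y]+[x,K(y)]$, $\rho^L_K(x)v=[K(x),v]-K([x,v])$, $\rho^R_K(x)v=[v,K(x)]-K([v,x])$. - For $f\in\mathrm{Hom}(\mathfrak{g},\mathfrak{g})$: $(\delta^1f)(x,y)=[x,f(y)]+[f(x),y]-f([x,y])$ and $\Phi^1(f)=f\circ K-K\circ f$. - For $f\in\mathrm{Hom}(\mathfrak{g}^{\otimes2},\mathfrak{g})$: $(\delta^2f)(x,y,z)=[x,f(y,z)]-[y,f(x,z)]-[f(x,y),z]-f([x,y],z)-f(y,[x,z])+f(x,[y,z])$ and $\Phi^2(f)(x,y)=f(K(x),K(y))-K(f(K(x),y)+f(x,K(y)))-\lambda f(x,y)$. - For $v\in\mathfrak{g}$: $(\partial^0v)(x)=-\rho^R_K(x)v$. For $g\in\mathrm{Hom}(\mathfrak{g},\mathfrak{g})$: $(\partial^1g)(x,y)=\rho^L_K(x)g(y)+\rho^R_K(y)g(x)-g([x,y]_K)$. Set $C^1_{\mathrm{MLeib}}(\mathfrak{g})=\mathrm{Hom}(\mathfrak{g},\mathfrak{g})\oplus\mathfrak{g}$,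 $C^2_{\mathrm{MLeib}}(\mathfrak{g})=\mathrm{Hom}(\mathfrak{g}^{\otimes2},\mathfrak{g})\oplus\mathrm{Hom}(\mathfrak{g},\mathfrak{g})$, $d^1(f,v)=(\delta^1f,-\partial^0v-\Phi^1f)$, $d^2(f,g)=(\delta^2f,-\partial^1g-\Phi^2f)$. Then $H^2_{\mathrm{MLeib}}(\mathfrak{g})=\ker d^2/\mathrm{im}\,d^1$. *)

theory Defs
  imports
    "HOL-Computational_Algebra.Formal_Power_Series"
    "HOL-Library.Function_Algebras"
    "HOL-Library.Product_Plus"
begin

section \<open>Modified Rota-Baxter Leibniz algebras\<close>

definition module_bilinear ::
    "('r::comm_ring_1 \<Rightarrow> 'a::ab_group_add \<Rightarrow> 'a) \<Rightarrow> ('a \<Rightarrow> 'a \<Rightarrow> 'a) \<Rightarrow> bool" where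
  "module_bilinear s b \<longleftrightarrow>
     (\<forall>x. module_hom s s (\<lambda>y. b x y)) \<and> (\<forall>y. module_hom s s (\<lambda>x. b x y))"

text \<open>The base is an arbitrary commutative ring, since the same notion is needed over a field
  \<open>k\<close> and over \<open>k[[t]]\<close>. Over a field, \<^locale>\<open>module\<close> is the notion of a vector space.\<close>

locale leibniz_algebra = module scale
  for scale :: "'r::comm_ring_1 \<Rightarrow> 'a::ab_group_add \<Rightarrow> 'a" +
  fixes br :: "'a \<Rightarrow> 'a \<Rightarrow> 'a"
  assumes bilinear_br: "module_bilinear scale br"
    and left_leibniz: "br x (br y z) = br (br x y) z + br y (br x z)"

locale modified_rota_baxter_leibniz_algebra = leibniz_algebra scale br
  for scale :: "'r::comm_ring_1 \<Rightarrow> 'a::ab_group_add \<Rightarrow> 'a" and br :: "'a \<Rightarrow> 'a \<Rightarrow> 'a" +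
  fixes K :: "'a \<Rightarrow> 'a" and lam :: 'r
  assumes linear_K: "module_hom scale scale K"
    and modified_rota_baxter: "br (K x) (K y) = K (br (K x) y + br x (K y)) + scale lam (br x y)"


section \<open>Cohomology with coefficients in the regular representation\<close>

definition bracket_K :: "('a \<Rightarrow> 'a \<Rightarrow> 'a) \<Rightarrow> ('a \<Rightarrow> 'a) \<Rightarrow> 'a \<Rightarrow> 'a \<Rightarrow> 'a::ab_group_add" where
  "bracket_K br K x y = br (K x) y + br x (K y)"

definition rhoL_K :: "('a \<Rightarrow> 'a \<Rightarrow> 'a) \<Rightarrow> ('a \<Rightarrow> 'a) \<Rightarrow> 'a \<Rightarrow> 'a \<Rightarrow> 'a::ab_group_add" where
  "rhoL_K br K x v = br (K x) v - K (br x v)"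

definition rhoR_K :: "('a \<Rightarrow> 'a \<Rightarrow> 'a) \<Rightarrow> ('a \<Rightarrow> 'a) \<Rightarrow> 'a \<Rightarrow> 'a \<Rightarrow> 'a::ab_group_add" where
  "rhoR_K br K x v = br v (K x) - K (br v x)"

definition delta1 :: "('a \<Rightarrow> 'a \<Rightarrow> 'a) \<Rightarrow> ('a \<Rightarrow> 'a) \<Rightarrow> 'a \<Rightarrow> 'a \<Rightarrow> 'a::ab_group_add" where
  "delta1 br f x y = br x (f y) + br (f x) y - f (br x y)"

definition delta2 ::
    "('a \<Rightarrow> 'a \<Rightarrow> 'a) \<Rightarrow> ('a \<Rightarrow> 'a \<Rightarrow> 'a) \<Rightarrow> 'a \<Rightarrow> 'a \<Rightarrow> 'a \<Rightarrow> 'a::ab_group_add" where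
  "delta2 br f x y z =
     br x (f y z) - br y (f x z) - br (f x y) z - f (br x y) z - f y (br x z) + f x (br y z)"

definition Phi1 :: "('a \<Rightarrow> 'a) \<Rightarrow> ('a \<Rightarrow> 'a) \<Rightarrow> 'a \<Rightarrow> 'a::ab_group_add" where
  "Phi1 K f x = f (K x) - K (f x)"

definition Phi2 ::
    "('r \<Rightarrow> 'a \<Rightarrow> 'a) \<Rightarrow> ('a \<Rightarrow> 'a) \<Rightarrow> 'r \<Rightarrow> ('a \<Rightarrow> 'a \<Rightarrow> 'a) \<Rightarrow> 'a \<Rightarrow> 'a \<Rightarrow> 'a::ab_group_add" where
  "Phi2 scale K lam f x y = f (K x) (K y) - K (f (K x) y + f x (K y)) - scale lam (f x y)"

definition partial0 :: "('a \<Rightarrow> 'a \<Rightarrow> 'a) \<Rightarrow> ('a \<Rightarrow> 'a) \<Rightarrow> 'a \<Rightarrow> 'a \<Rightarrow> 'a::ab_group_add" where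
  "partial0 br K v x = - rhoR_K br K x v"

definition partial1 ::
    "('a \<Rightarrow> 'a \<Rightarrow> 'a) \<Rightarrow> ('a \<Rightarrow> 'a) \<Rightarrow> ('a \<Rightarrow> 'a) \<Rightarrow> 'a \<Rightarrow> 'a \<Rightarrow> 'a::ab_group_add" where
  "partial1 br K g x y = rhoL_K br K x (g y) + rhoR_K br K y (g x) - g (bracket_K br K x y)"

definition C1_MLeib ::
    "('r::comm_ring_1 \<Rightarrow> 'a::ab_group_add \<Rightarrow> 'a) \<Rightarrow> (('a \<Rightarrow> 'a) \<times> 'a) set" where
  "C1_MLeib scale = {f. module_hom scale scale f} \<times> UNIV"

definition C2_MLeib ::
    "('r::comm_ring_1 \<Rightarrow> 'a::ab_group_add \<Rightarrow> 'a) \<Rightarrow> (('a \<Rightarrow> 'a \<Rightarrow> 'a) \<times> ('a \<Rightarrow> 'a)) set" where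
  "C2_MLeib scale = {f. module_bilinear scale f} \<times> {g. module_hom scale scale g}"

text \<open>Below, \<open>-\<close> and \<open>0\<close> on functions and pairs are pointwise and componentwise.\<close>

definition d1_MLeib ::
    "('a \<Rightarrow> 'a \<Rightarrow> 'a) \<Rightarrow> ('a \<Rightarrow> 'a) \<Rightarrow>
     ('a \<Rightarrow> 'a) \<times> 'a \<Rightarrow> ('a \<Rightarrow> 'a \<Rightarrow> 'a) \<times> ('a \<Rightarrow> 'a::ab_group_add)" where
  "d1_MLeib br K = (\<lambda>(f, v). (delta1 br f, - partial0 br K v - Phi1 K f))"

definition d2_MLeib ::
    "('r \<Rightarrow> 'a \<Rightarrow> 'a) \<Rightarrow> ('a \<Rightarrow> 'a \<Rightarrow> 'a) \<Rightarrow> ('a \<Rightarrow> 'a) \<Rightarrow> 'r \<Rightarrow>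
     ('a \<Rightarrow> 'a \<Rightarrow> 'a) \<times> ('a \<Rightarrow> 'a) \<Rightarrow> ('a \<Rightarrow> 'a \<Rightarrow> 'a \<Rightarrow> 'a) \<times> ('a \<Rightarrow> 'a \<Rightarrow> 'a::ab_group_add)" where
  "d2_MLeib scale br K lam = (\<lambda>(f, g). (delta2 br f, - partial1 br K g - Phi2 scale K lam f))"

definition Z2_MLeib ::
    "('r::comm_ring_1 \<Rightarrow> 'a::ab_group_add \<Rightarrow> 'a) \<Rightarrow> ('a \<Rightarrow> 'a \<Rightarrow> 'a) \<Rightarrow> ('a \<Rightarrow> 'a) \<Rightarrow> 'r \<Rightarrow>
     (('a \<Rightarrow> 'a \<Rightarrow> 'a) \<times> ('a \<Rightarrow> 'a)) set" where
  "Z2_MLeib scale br K lam = {c \<in> C2_MLeib scale. d2_MLeib scale br K lam c = 0}"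

definition B2_MLeib ::
    "('r::comm_ring_1 \<Rightarrow> 'a::ab_group_add \<Rightarrow> 'a) \<Rightarrow> ('a \<Rightarrow> 'a \<Rightarrow> 'a) \<Rightarrow> ('a \<Rightarrow> 'a) \<Rightarrow>
     (('a \<Rightarrow> 'a \<Rightarrow> 'a) \<times> ('a \<Rightarrow> 'a)) set" where
  "B2_MLeib scale br K = d1_MLeib br K ` C1_MLeib scale"

text \<open>The underlying set of the quotient: the cosets \<open>z + B\<^sup>2\<close> with \<open>z \<in> Z\<^sup>2\<close>. Its zero
  element is the coset \<open>B\<^sup>2\<close>, so that \<open>H\<^sup>2 = 0\<close> is \<open>H2_MLeib scale br K lam = {B2_MLeib scale br K}\<close>.\<close>

definition H2_MLeib ::
    "('r::comm_ring_1 \<Rightarrow> 'a::ab_group_add \<Rightarrow> 'a) \<Rightarrow> ('a \<Rightarrow> 'a \<Rightarrow> 'a) \<Rightarrow> ('a \<Rightarrow> 'a) \<Rightarrow> 'r \<Rightarrow>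
     (('a \<Rightarrow> 'a \<Rightarrow> 'a) \<times> ('a \<Rightarrow> 'a)) set set" where
  "H2_MLeib scale br K lam = (\<lambda>z. (+) z ` B2_MLeib scale br K) ` Z2_MLeib scale br K lam"

lemma (in modified_rota_baxter_leibniz_algebra) B2_MLeib_subset_Z2_MLeib:
  "B2_MLeib scale br K \<subseteq> Z2_MLeib scale br K lam"
proof
  note br = bilinear_br[unfolded module_bilinear_def]
  have brR: "module_hom scale scale (br x)" for x using br by auto
  have brL: "module_hom scale scale (\<lambda>x. br x y)" for y using br by auto
  note bs = module_hom.add[OF brR] module_hom.scale[OF brR] module_hom.diff[OF brR]
    module_hom.neg[OF brR]
    module_hom.add[OF brL] module_hom.scale[OF brL] module_hom.diff[OF brL] module_hom.neg[OF brL]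
  note Ks = module_hom.add[OF linear_K] module_hom.scale[OF linear_K]
    module_hom.diff[OF linear_K] module_hom.neg[OF linear_K]
  fix c assume "c \<in> B2_MLeib scale br K"
  then obtain f v where f: "module_hom scale scale f" and c: "c = d1_MLeib br K (f, v)"
    by (auto simp: B2_MLeib_def C1_MLeib_def)
  note fs = module_hom.add[OF f] module_hom.scale[OF f] module_hom.diff[OF f] module_hom.neg[OF f]
  note ss = scale_right_distrib scale_right_diff_distrib
  have m: "module scale" by unfold_locales
  have bil: "module_bilinear scale (delta1 br f)"
    unfolding module_bilinear_def module_hom_def module_hom_axioms_def delta1_def
    by (simp add: m bs fs ss algebra_simps)
  have lin: "module_hom scale scale (- partial0 br K v - Phi1 K f)"
    unfolding module_hom_def module_hom_axioms_def partial0_def rhoR_K_def Phi1_def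
    by (simp add: m bs fs Ks ss algebra_simps)
  have d2: "delta2 br (delta1 br f) x y z = 0" for x y z
    unfolding delta2_def delta1_def
    by (simp add: bs fs left_leibniz[of x y] left_leibniz[of "f x" y] left_leibniz[of x "f y"]
        left_leibniz[of x y "f z"] algebra_simps)
  have "partial1 br K (- partial0 br K v - Phi1 K f) x y + Phi2 scale K lam (delta1 br f) x y = 0"
    for x y
  proof -
    have l1: "br v (br a b) = br (br v a) b + br a (br v b)" for a b by (rule left_leibniz)
    note rb = modified_rota_baxter[unfolded Ks]
    show ?thesis
      unfolding partial1_def partial0_def Phi1_def Phi2_def delta1_def rhoL_K_def rhoR_K_def
        bracket_K_def
      using rb[of "br v x" y] rb[of x "br v y"] rb[of "f x" y] rb[of x "f y"]
        arg_cong[OF rb[of x y], of "br v"] arg_cong[OF rb[of x y], of f]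
      by (simp add: bs fs Ks ss l1 algebra_simps)
  qed
  then have "- partial1 br K (- partial0 br K v - Phi1 K f) - Phi2 scale K lam (delta1 br f) = 0"
    by (auto simp: fun_eq_iff intro: minus_unique)
  with bil lin d2 show "c \<in> Z2_MLeib scale br K lam"
    by (simp add: c Z2_MLeib_def C2_MLeib_def d1_MLeib_def d2_MLeib_def fun_eq_iff zero_prod_def)
qed


section \<open>Formal deformations\<close>

text \<open>The \<open>k[[t]]\<close>-module \<open>g[[t]]\<close> is the type of formal power series over \<open>g\<close>. A formal series
  of maps such as \<open>\<mu>\<^sub>t\<close> is given by the sequence of its coefficients.\<close>

definition fps_scale :: "('k \<Rightarrow> 'a \<Rightarrow> 'a) \<Rightarrow> 'k fps \<Rightarrow> 'a fps \<Rightarrow> 'a::ab_group_add fps" where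
  "fps_scale scale a v = Abs_fps (\<lambda>n. \<Sum>i\<le>n. scale (fps_nth a i) (fps_nth v (n - i)))"

text \<open>The extension of \<open>\<Sum>\<^sub>i F\<^sub>i t\<^sup>i\<close> to \<open>g[[t]]\<close> sends \<open>\<Sum>\<^sub>j v\<^sub>j t\<^sup>j\<close> to \<open>\<Sum>\<^sub>i\<^sub>,\<^sub>j F\<^sub>i(v\<^sub>j) t\<^sup>i\<^sup>+\<^sup>j\<close>,
  and that of \<open>\<Sum>\<^sub>i M\<^sub>i t\<^sup>i\<close> with bilinear \<open>M\<^sub>i\<close> is defined analogously.\<close>

definition fps_ext1 :: "(nat \<Rightarrow> 'a \<Rightarrow> 'a) \<Rightarrow> 'a fps \<Rightarrow> 'a::ab_group_add fps" where
  "fps_ext1 F v = Abs_fps (\<lambda>n. \<Sum>i\<le>n. F i (fps_nth v (n - i)))"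

definition fps_ext2 :: "(nat \<Rightarrow> 'a \<Rightarrow> 'a \<Rightarrow> 'a) \<Rightarrow> 'a fps \<Rightarrow> 'a fps \<Rightarrow> 'a::ab_group_add fps" where
  "fps_ext2 M v w =
     Abs_fps (\<lambda>n. \<Sum>i\<le>n. \<Sum>j\<le>n - i. M i (fps_nth v j) (fps_nth w (n - i - j)))"

definition formal_deformation ::
    "('k::field \<Rightarrow> 'g::ab_group_add \<Rightarrow> 'g) \<Rightarrow> ('g \<Rightarrow> 'g \<Rightarrow> 'g) \<Rightarrow> ('g \<Rightarrow> 'g) \<Rightarrow> 'k \<Rightarrow>
     (nat \<Rightarrow> 'g \<Rightarrow> 'g \<Rightarrow> 'g) \<Rightarrow> (nat \<Rightarrow> 'g \<Rightarrow> 'g) \<Rightarrow> bool" where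
  "formal_deformation scale mu K lam mut Kt \<longleftrightarrow>
     (\<forall>i. module_bilinear scale (mut i)) \<and> (\<forall>i. module_hom scale scale (Kt i)) \<and>
     mut 0 = mu \<and> Kt 0 = K \<and>
     modified_rota_baxter_leibniz_algebra (fps_scale scale) (fps_ext2 mut) (fps_ext1 Kt)
       (fps_const lam)"

definition equivalent_deformations ::
    "('k::field \<Rightarrow> 'g::ab_group_add \<Rightarrow> 'g) \<Rightarrow>
     (nat \<Rightarrow> 'g \<Rightarrow> 'g \<Rightarrow> 'g) \<Rightarrow> (nat \<Rightarrow> 'g \<Rightarrow> 'g) \<Rightarrow>
     (nat \<Rightarrow> 'g \<Rightarrow> 'g \<Rightarrow> 'g) \<Rightarrow> (nat \<Rightarrow> 'g \<Rightarrow> 'g) \<Rightarrow> bool" where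
  "equivalent_deformations scale mut Kt mut' Kt' \<longleftrightarrow>
     (\<exists>psi. (\<forall>i. module_hom scale scale (psi i)) \<and> psi 0 = id \<and> bij (fps_ext1 psi) \<and>
        (\<forall>v w. fps_ext1 psi (fps_ext2 mut' v w) = fps_ext2 mut (fps_ext1 psi v) (fps_ext1 psi w)) \<and>
        (\<forall>v. fps_ext1 psi (fps_ext1 Kt' v) = fps_ext1 Kt (fps_ext1 psi v)))"

definition constant_series :: "'b \<Rightarrow> nat \<Rightarrow> 'b::zero" where
  "constant_series a i = (if i = 0 then a else 0)"

definition trivial_deformation ::
    "('k::field \<Rightarrow> 'g::ab_group_add \<Rightarrow> 'g) \<Rightarrow> ('g \<Rightarrow> 'g \<Rightarrow> 'g) \<Rightarrow> ('g \<Rightarrow> 'g) \<Rightarrow>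
     (nat \<Rightarrow> 'g \<Rightarrow> 'g \<Rightarrow> 'g) \<Rightarrow> (nat \<Rightarrow> 'g \<Rightarrow> 'g) \<Rightarrow> bool" where
  "trivial_deformation scale mu K mut Kt \<longleftrightarrow>
     equivalent_deformations scale mut Kt (constant_series mu) (constant_series K)"

definition rigid ::
    "('k::field \<Rightarrow> 'g::ab_group_add \<Rightarrow> 'g) \<Rightarrow> ('g \<Rightarrow> 'g \<Rightarrow> 'g) \<Rightarrow> ('g \<Rightarrow> 'g) \<Rightarrow> 'k \<Rightarrow> bool" where
  "rigid scale mu K lam \<longleftrightarrow>
     (\<forall>mut Kt. formal_deformation scale mu K lam mut Kt \<longrightarrow> trivial_deformation scale mu K mut Kt)"

end

theory Submission
  imports Defs
begin

text \<open>A formal isomorphism \<open>\<psi>\<^sub>t\<close> onto the constant deformation is built coefficient by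
  coefficient. If \<open>\<psi>\<^sub>0, \<dots>, \<psi>\<^sub>n\<^sub>-\<^sub>1\<close> intertwine the structures modulo \<open>t\<^sup>n\<close>, the two defects
  \<open>\<mu>\<^sub>t(\<psi>\<^sub>t x, \<psi>\<^sub>t y) - \<psi>\<^sub>t [x, y]\<close> and \<open>K\<^sub>t (\<psi>\<^sub>t x) - \<psi>\<^sub>t (K x)\<close> are divisible by \<open>t\<^sup>n\<close>. Reading the
  Leibniz and modified Rota-Baxter identities of the deformation on the image of \<open>\<psi>\<^sub>t\<close> modulo
  \<open>t\<^sup>n\<^sup>+\<^sup>1\<close> shows that their leading coefficients form a 2-cocycle. It is a coboundary
  \<open>d\<^sup>1(f, v)\<close>, and since \<open>d\<^sup>1([v, \<cdot>], 0) = d\<^sup>1(0, -v)\<close>, it is \<open>d\<^sup>1(g, 0)\<close> for \<open>g = f - [v, \<cdot>]\<close>.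
  Subtracting \<open>g\<close> from \<open>\<psi>\<^sub>n\<close> removes the defects of order \<open>n\<close>, without changing
  \<open>\<psi>\<^sub>0, \<dots>, \<psi>\<^sub>n\<^sub>-\<^sub>1\<close>.\<close>

section \<open>Extension of series of maps to formal power series\<close>

text \<open>Scalars are left out so that one notion covers brackets over \<open>k\<close> as well as
  over \<open>k[[t]]\<close>.\<close>

definition biadditive :: "('a::ab_group_add \<Rightarrow> 'a \<Rightarrow> 'a) \<Rightarrow> bool" where
  "biadditive b \<longleftrightarrow> (\<forall>x. additive (b x)) \<and> (\<forall>y. additive (\<lambda>x. b x y))"

lemma biadditiveD:
  assumes "biadditive b"
  shows "b x (y + z) = b x y + b x z" "b (x + y) z = b x z + b y z"
    "b x (y - z) = b x y - b x z" "b (x - y) z = b x z - b y z"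
    "b x 0 = 0" "b 0 z = 0"
  using assms additive.add[of "b x"] additive.add[of "\<lambda>x. b x z"]
    additive.diff[of "b x"] additive.diff[of "\<lambda>x. b x z"]
    additive.zero[of "b x"] additive.zero[of "\<lambda>x. b x z"]
  unfolding biadditive_def by auto

lemma module_hom_imp_additive: "module_hom s1 s2 f \<Longrightarrow> additive f"
  by (simp add: additive_def module_hom.add)

lemma module_bilinear_imp_biadditive: "module_bilinear s b \<Longrightarrow> biadditive b"
  unfolding biadditive_def module_bilinear_def by (blast intro: module_hom_imp_additive)

section \<open>Additivity of the extended maps and multiplication by t\<close>

lemma additive_fps_ext1: "(\<And>i. additive (F i)) \<Longrightarrow> additive (fps_ext1 F)"
  by (rule additive.intro)
    (simp add: fps_eq_iff fps_ext1_def additive.add sum.distrib)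

lemma biadditive_fps_ext2:
  assumes "\<And>i. biadditive (M i)"
  shows "biadditive (fps_ext2 M)"
  unfolding biadditive_def additive_def
  by (simp add: fps_eq_iff fps_ext2_def biadditiveD(1,2)[OF assms] sum.distrib)

text \<open>Multiplication by t, given by coefficients because \<open>'a\<close> has no product in
  which to form \<open>fps_X * v\<close>.\<close>

definition shift_up :: "'a::ab_group_add fps \<Rightarrow> 'a fps" where
  "shift_up v = Abs_fps (\<lambda>n. case n of 0 \<Rightarrow> 0 | Suc m \<Rightarrow> fps_nth v m)"

lemma shift_up_nth [simp]:
  "fps_nth (shift_up v) 0 = 0" "fps_nth (shift_up v) (Suc n) = fps_nth v n"
  by (simp_all add: shift_up_def)

lemma fps_ext1_shift_up:
  assumes "\<And>i. additive (F i)"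
  shows "fps_ext1 F (shift_up v) = shift_up (fps_ext1 F v)"
proof (rule fps_ext)
  fix n
  show "fps_nth (fps_ext1 F (shift_up v)) n = fps_nth (shift_up (fps_ext1 F v)) n"
    by (cases n) (auto simp: fps_ext1_def additive.zero[OF assms] Suc_diff_le intro!: sum.cong)
qed

lemma fps_ext2_shift_up:
  assumes "\<And>i. biadditive (M i)"
  shows "fps_ext2 M (shift_up v) w = shift_up (fps_ext2 M v w)" (is ?L)
    and "fps_ext2 M v (shift_up w) = shift_up (fps_ext2 M v w)" (is ?R)
proof -
  have inner: "(\<Sum>j\<le>Suc k. M i (fps_nth (shift_up v) j) (fps_nth w (Suc k - j)))
      = (\<Sum>j\<le>k. M i (fps_nth v j) (fps_nth w (k - j)))" for i k
    by (simp add: sum.atMost_Suc_shift biadditiveD(6)[OF assms] del: sum.atMost_Suc)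
  have "fps_nth (fps_ext2 M (shift_up v) w) n = fps_nth (shift_up (fps_ext2 M v w)) n" for n
  proof (cases n)
    case 0
    then show ?thesis by (simp add: fps_ext2_def biadditiveD(6)[OF assms])
  next
    case (Suc k)
    \<comment> \<open>The outer term i = \<open>Suc k\<close> drops out: its inner sum consists of j
      = 0 only, where \<open>shift_up v\<close> vanishes.\<close>
    have "fps_nth (fps_ext2 M (shift_up v) w) (Suc k)
        = (\<Sum>i\<le>k. \<Sum>j\<le>Suc (k - i). M i (fps_nth (shift_up v) j) (fps_nth w (Suc (k - i) - j)))"
      by (simp add: fps_ext2_def biadditiveD(6)[OF assms] Suc_diff_le del: sum.atMost_Suc)
        (simp add: biadditiveD(6)[OF assms] Suc_diff_le)
    also have "\<dots> = (\<Sum>i\<le>k. \<Sum>j\<le>k - i. M i (fps_nth v j) (fps_nth w (k - i - j)))"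
      by (simp only: inner)
    finally show ?thesis by (simp add: Suc fps_ext2_def)
  qed
  then show ?L by (simp add: fps_eq_iff)
  have "fps_nth (fps_ext2 M v (shift_up w)) n = fps_nth (shift_up (fps_ext2 M v w)) n" for n
    by (cases n) (auto simp: fps_ext2_def biadditiveD(5)[OF assms] Suc_diff_le intro!: sum.cong)
  then show ?R by (simp add: fps_eq_iff)
qed

text \<open>Write v = c + t v' with c constant. Since F kills c, F v = t F v'; iterating, every
  power of t divides F v. This reduces identities on all series to constant ones.\<close>

lemma additive_shift_up_eq_zero:
  assumes "additive F" and "\<And>v. F (shift_up v) = shift_up (F v)" and "\<And>x. F (fps_const x) = 0"
  shows "F v = 0"
proof -
  have step: "F v = shift_up (F (fps_shift 1 v))" for v
  proof -
    have "v = fps_const (fps_nth v 0) + shift_up (fps_shift 1 v)"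
      by (auto simp: fps_eq_iff shift_up_def split: nat.split)
    then show ?thesis
      by (metis assms additive.add add_0)
  qed
  have "fps_nth (F v) n = 0" for n
  proof (induction n arbitrary: v)
    case 0
    show ?case by (subst step) simp
  next
    case (Suc n)
    show ?case by (subst step) (simp add: Suc)
  qed
  then show ?thesis by (simp add: fps_eq_iff)
qed

section \<open>Leading coefficients of series divisible by a power of t\<close>

definition vanishes_below :: "nat \<Rightarrow> 'a::zero fps \<Rightarrow> bool" where
  "vanishes_below n v \<longleftrightarrow> (\<forall>m<n. fps_nth v m = 0)"

text \<open>For i > 0 the map \<open>F i\<close> meets the coefficient m - i < n of v, which is
  zero; so modulo t^(n+1) only \<open>F 0\<close> acts.\<close>

lemma fps_ext1_nth_leading:
  assumes "\<And>i. additive (F i)" and "vanishes_below n v" and "m \<le> n"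
  shows "fps_nth (fps_ext1 F v) m = F 0 (fps_nth v m)"
proof -
  have v: "fps_nth v k = 0" if "k < m" for k
    using that assms by (simp add: vanishes_below_def)
  have "(\<Sum>i\<le>m. F i (fps_nth v (m - i))) = (\<Sum>i\<in>{0}. F i (fps_nth v (m - i)))"
    by (rule sum.mono_neutral_right)
      (auto simp: v additive.zero[OF assms(1)])
  then show ?thesis by (simp add: fps_ext1_def)
qed

lemma fps_ext2_nth_leading:
  assumes "\<And>i. biadditive (M i)" and "vanishes_below n v" and "m \<le> n"
  shows "fps_nth (fps_ext2 M u v) m = M 0 (fps_nth u 0) (fps_nth v m)" (is ?R)
    and "fps_nth (fps_ext2 M v u) m = M 0 (fps_nth v m) (fps_nth u 0)" (is ?L)
proof -
  note z = biadditiveD(5,6)[OF assms(1)]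
  have v: "fps_nth v k = 0" if "k < m" for k
    using that assms by (simp add: vanishes_below_def)
  have "(\<Sum>i\<le>m. \<Sum>j\<le>m - i. M i (fps_nth u j) (fps_nth v (m - i - j)))
      = (\<Sum>i\<in>{0}. \<Sum>j\<le>m - i. M i (fps_nth u j) (fps_nth v (m - i - j)))"
    by (rule sum.mono_neutral_right) (auto simp: v z intro!: sum.neutral)
  also have "\<dots> = (\<Sum>j\<le>m. M 0 (fps_nth u j) (fps_nth v (m - j)))"
    by simp
  also have "\<dots> = (\<Sum>j\<in>{0}. M 0 (fps_nth u j) (fps_nth v (m - j)))"
    by (rule sum.mono_neutral_right) (auto simp: v z)
  finally show ?R by (simp add: fps_ext2_def)
  have "(\<Sum>i\<le>m. \<Sum>j\<le>m - i. M i (fps_nth v j) (fps_nth u (m - i - j)))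
      = (\<Sum>i\<in>{0}. \<Sum>j\<le>m - i. M i (fps_nth v j) (fps_nth u (m - i - j)))"
    by (rule sum.mono_neutral_right) (auto simp: v z intro!: sum.neutral)
  also have "\<dots> = (\<Sum>j\<le>m. M 0 (fps_nth v j) (fps_nth u (m - j)))"
    by simp
  also have "\<dots> = (\<Sum>j\<in>{m}. M 0 (fps_nth v j) (fps_nth u (m - j)))"
    by (rule sum.mono_neutral_right) (auto simp: v z)
  finally show ?L by (simp add: fps_ext2_def)
qed

lemma fps_ext1_cong:
  "(\<And>m. m \<le> n \<Longrightarrow> fps_nth v m = fps_nth v' m) \<Longrightarrow>
    fps_nth (fps_ext1 F v) n = fps_nth (fps_ext1 F v') n"
  by (simp add: fps_ext1_def)

lemma fps_ext2_cong:
  "(\<And>m. m \<le> n \<Longrightarrow> fps_nth v m = fps_nth v' m) \<Longrightarrow>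
   (\<And>m. m \<le> n \<Longrightarrow> fps_nth w m = fps_nth w' m) \<Longrightarrow>
    fps_nth (fps_ext2 M v w) n = fps_nth (fps_ext2 M v' w') n"
  by (simp add: fps_ext2_def)

section \<open>Bijectivity of a series of maps with constant term the identity\<close>

text \<open>The equation \<open>fps_ext1 F v = w\<close> reads \<open>v\<^sub>n = w\<^sub>n - \<Sum>\<^sub>i\<^sub><\<^sub>n F\<^sub>n\<^sub>-\<^sub>i(v\<^sub>i)\<close>.\<close>

fun fps_ext1_preimage :: "(nat \<Rightarrow> 'a \<Rightarrow> 'a) \<Rightarrow> 'a fps \<Rightarrow> nat \<Rightarrow> 'a::ab_group_add" where
  "fps_ext1_preimage F w n = fps_nth w n - (\<Sum>i<n. F (n - i) (fps_ext1_preimage F w i))"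

declare fps_ext1_preimage.simps [simp del]

lemma bij_fps_ext1:
  assumes "F 0 = id"
  shows "bij (fps_ext1 F)"
proof (rule bijI)
  \<comment> \<open>Reversing the summation index isolates \<open>F 0\<close>, the identity, on the
    top coefficient, so the system is triangular.\<close>
  have nth: "fps_nth (fps_ext1 F v) n = fps_nth v n + (\<Sum>i<n. F (n - i) (fps_nth v i))" for v n
  proof -
    have "fps_nth (fps_ext1 F v) n = (\<Sum>i\<le>n. F (n - i) (fps_nth v i))"
      unfolding fps_ext1_def fps_nth_Abs_fps
      by (rule sum.reindex_bij_witness[of _ "\<lambda>i. n - i" "\<lambda>i. n - i"]) auto
    then show ?thesis by (simp add: assms add.commute flip: lessThan_Suc_atMost)
  qed
  show "inj (fps_ext1 F)"
  proof (rule injI, rule fps_ext)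
    fix v w n
    assume eq: "fps_ext1 F v = fps_ext1 F w"
    show "fps_nth v n = fps_nth w n"
    proof (induction n rule: less_induct)
      case (less n)
      then show ?case using nth[of v n] nth[of w n] eq by simp
    qed
  qed
  show "surj (fps_ext1 F)"
  proof (rule surjI, rule fps_ext)
    fix w n
    show "fps_nth (fps_ext1 F (Abs_fps (fps_ext1_preimage F w))) n = fps_nth w n"
      by (simp add: nth fps_ext1_preimage.simps[of F w n])
  qed
qed

section \<open>Constant series of maps, vectors and scalars\<close>

lemma fps_ext2_constant_series_const:
  assumes "biadditive b"
  shows "fps_ext2 (constant_series b) (fps_const x) (fps_const y) = fps_const (b x y)"
proof (rule fps_ext)
  fix n
  have "(\<Sum>i\<le>n. \<Sum>j\<le>n - i. constant_series b i (if j = 0 then x else 0)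
        (if n - i - j = 0 then y else 0))
      = (\<Sum>i\<in>{0}. \<Sum>j\<le>n - i. constant_series b i (if j = 0 then x else 0)
        (if n - i - j = 0 then y else 0))"
    by (rule sum.mono_neutral_right) (auto simp: constant_series_def)
  also have "\<dots> = (\<Sum>j\<le>n. b (if j = 0 then x else 0) (if n - j = 0 then y else 0))"
    by (simp add: constant_series_def)
  also have "\<dots> = (\<Sum>j\<in>{0}. b (if j = 0 then x else 0) (if n - j = 0 then y else 0))"
    by (rule sum.mono_neutral_right) (auto simp: biadditiveD[OF assms])
  finally show "fps_nth (fps_ext2 (constant_series b) (fps_const x) (fps_const y)) n
      = fps_nth (fps_const (b x y)) n"
    by (simp add: fps_ext2_def biadditiveD[OF assms])
qed

lemma fps_ext1_const:
  "(\<And>i. additive (F i)) \<Longrightarrow> fps_ext1 F (fps_const x) = Abs_fps (\<lambda>i. F i x)"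
proof (rule fps_ext)
  fix n
  assume F: "\<And>i. additive (F i)"
  have "(\<Sum>i\<le>n. F i (if n - i = 0 then x else 0)) = (\<Sum>i\<in>{n}. F i (if n - i = 0 then x else 0))"
    by (rule sum.mono_neutral_right) (auto simp: additive.zero[OF F])
  then show "fps_nth (fps_ext1 F (fps_const x)) n = fps_nth (Abs_fps (\<lambda>i. F i x)) n"
    by (simp add: fps_ext1_def)
qed

lemma fps_scale_const_nth:
  assumes "module scale"
  shows "fps_nth (fps_scale scale (fps_const a) v) n = scale a (fps_nth v n)"
proof -
  interpret module scale by fact
  have "(\<Sum>i\<le>n. scale (if i = 0 then a else 0) (fps_nth v (n - i)))
      = (\<Sum>i\<in>{0}. scale (if i = 0 then a else 0) (fps_nth v (n - i)))"
    by (rule sum.mono_neutral_right) auto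
  then show ?thesis by (simp add: fps_scale_def)
qed

section \<open>Coboundaries\<close>

text \<open>By the left Leibniz identity \<open>br v\<close> is a derivation, so
  \<open>delta1\<close> kills it, and \<open>Phi1 K (br v)\<close> equals
  \<open>- partial0 br K v\<close>. Hence v can be absorbed into the linear map, which alone is
  available for correcting a coefficient of psi.\<close>

lemma (in modified_rota_baxter_leibniz_algebra) B2_MLeib_eq:
  "B2_MLeib scale br K = (\<lambda>g. d1_MLeib br K (g, 0)) ` {g. module_hom scale scale g}"
proof
  have m: "module scale" by unfold_locales
  show "B2_MLeib scale br K \<subseteq> (\<lambda>g. d1_MLeib br K (g, 0)) ` {g. module_hom scale scale g}"
  proof
    fix c assume "c \<in> B2_MLeib scale br K"
    then obtain f v where f: "module_hom scale scale f" and c: "c = d1_MLeib br K (f, v)"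
      by (auto simp: B2_MLeib_def C1_MLeib_def)
    have brv: "module_hom scale scale (br v)"
      using bilinear_br by (simp add: module_bilinear_def)
    note b = biadditiveD[OF module_bilinear_imp_biadditive[OF bilinear_br]]
    define g where "g = (\<lambda>x. f x - br v x)"
    have g: "module_hom scale scale g"
      unfolding g_def using module_pair.module_hom_sub[OF module_pair.intro[OF m m] f brv] .
    have "c = d1_MLeib br K (g, 0)"
      by (auto simp: c d1_MLeib_def fun_eq_iff delta1_def partial0_def Phi1_def rhoR_K_def g_def b
          left_leibniz[of v] module_hom.diff[OF linear_K] module_hom.zero[OF linear_K]
          algebra_simps)
    with g show "c \<in> (\<lambda>g. d1_MLeib br K (g, 0)) ` {g. module_hom scale scale g}" by blast
  qed
  show "(\<lambda>g. d1_MLeib br K (g, 0)) ` {g. module_hom scale scale g} \<subseteq> B2_MLeib scale br K"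
    by (auto simp: B2_MLeib_def C1_MLeib_def)
qed

text \<open>The coset of z contains z because B^2 contains 0, and by assumption this coset is
  B^2.\<close>

lemma (in modified_rota_baxter_leibniz_algebra) Z2_MLeib_subset_B2_MLeib:
  assumes "H2_MLeib scale br K lam = {B2_MLeib scale br K}"
  shows "Z2_MLeib scale br K lam \<subseteq> B2_MLeib scale br K"
proof
  fix z assume "z \<in> Z2_MLeib scale br K lam"
  then have "(+) z ` B2_MLeib scale br K = B2_MLeib scale br K"
    using assms unfolding H2_MLeib_def by blast
  moreover have "0 \<in> B2_MLeib scale br K"
  proof -
    have "module_hom scale scale (\<lambda>x. 0)"
      by (simp add: module_hom_def module_hom_axioms_def module_axioms)
    moreover have "d1_MLeib br K (\<lambda>x. 0, 0) = 0"
      by (simp add: d1_MLeib_def delta1_def partial0_def rhoR_K_def Phi1_def zero_prod_def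
          fun_eq_iff biadditiveD[OF module_bilinear_imp_biadditive[OF bilinear_br]]
          module_hom.zero[OF linear_K])
    ultimately show ?thesis
      unfolding B2_MLeib_def C1_MLeib_def
      by (intro image_eqI[of _ _ "(\<lambda>x. 0, 0)"]) auto
  qed
  ultimately show "z \<in> B2_MLeib scale br K"
    by (metis add_0_right image_eqI)
qed

section \<open>Construction of the trivialization\<close>

text \<open>For additive coefficients this is the extended map applied to the constant series
  x.\<close>

definition series_at :: "(nat \<Rightarrow> 'a \<Rightarrow> 'b) \<Rightarrow> 'a \<Rightarrow> 'b fps" where
  "series_at F x = Abs_fps (\<lambda>i. F i x)"

lemma series_at_nth [simp]: "fps_nth (series_at F x) i = F i x"
  by (simp add: series_at_def)

section \<open>The deformed structure over \<open>k[[t]]\<close> and the defects of a candidate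
  isomorphism\<close>

locale deformed_algebra = modified_rota_baxter_leibniz_algebra scale mu K lam
  for scale :: "'k::field \<Rightarrow> 'g::ab_group_add \<Rightarrow> 'g" and mu K lam +
  fixes mut :: "nat \<Rightarrow> 'g \<Rightarrow> 'g \<Rightarrow> 'g" and Kt :: "nat \<Rightarrow> 'g \<Rightarrow> 'g"
  assumes deformation: "formal_deformation scale mu K lam mut Kt"
begin

abbreviation "brt \<equiv> fps_ext2 mut"
abbreviation "opt \<equiv> fps_ext1 Kt"

sublocale def: modified_rota_baxter_leibniz_algebra "fps_scale scale" brt opt "fps_const lam"
  using deformation by (simp add: formal_deformation_def)

lemma module_scale: "module scale"
  by unfold_locales

lemma mut_Kt_0 [simp]: "mut 0 = mu" "Kt 0 = K"
  using deformation by (simp_all add: formal_deformation_def)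

lemma biadditive_mut: "biadditive (mut i)"
  using deformation by (auto simp: formal_deformation_def intro: module_bilinear_imp_biadditive)

lemma additive_Kt: "additive (Kt i)"
  using deformation by (auto simp: formal_deformation_def intro: module_hom_imp_additive)

lemmas additive_K = additive_Kt[of 0, simplified]
  and biadditive_mu = biadditive_mut[of 0, simplified]
  and additive_opt = additive_fps_ext1[of Kt, OF additive_Kt]
  and biadditive_brt = biadditive_fps_ext2[of mut, OF biadditive_mut]

lemmas brt_leading = fps_ext2_nth_leading[of mut, OF biadditive_mut, simplified]
  and opt_leading = fps_ext1_nth_leading[of Kt, OF additive_Kt, simplified]

text \<open>Arguments are taken in g only; t-linearity extends a zero defect to all of
  \<open>g[[t]]\<close> at the end.\<close>

definition bracket_defect :: "(nat \<Rightarrow> 'g \<Rightarrow> 'g) \<Rightarrow> 'g \<Rightarrow> 'g \<Rightarrow> 'g fps" where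
  "bracket_defect psi x y =
     brt (series_at psi x) (series_at psi y) - series_at psi (mu x y)"

definition operator_defect :: "(nat \<Rightarrow> 'g \<Rightarrow> 'g) \<Rightarrow> 'g \<Rightarrow> 'g fps" where
  "operator_defect psi x = opt (series_at psi x) - series_at psi (K x)"

definition intertwines_below :: "nat \<Rightarrow> (nat \<Rightarrow> 'g \<Rightarrow> 'g) \<Rightarrow> bool" where
  "intertwines_below n psi \<longleftrightarrow> psi 0 = id \<and> (\<forall>i. module_hom scale scale (psi i)) \<and>
     (\<forall>x y. vanishes_below n (bracket_defect psi x y)) \<and>
     (\<forall>x. vanishes_below n (operator_defect psi x))"

lemma series_at_linear:
  assumes "\<And>i. module_hom scale scale (psi i)"
  shows "series_at psi (x + y) = series_at psi x + series_at psi y"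
    and "series_at psi (scale a x) = fps_scale scale (fps_const a) (series_at psi x)"
  by (simp_all add: fps_eq_iff fps_scale_const_nth[OF module_scale]
      module_hom.add[OF assms] module_hom.scale[OF assms])

text \<open>Constant scalars act on series coefficientwise, so taking a coefficient is k-linear.
  This places the leading defects in C^2.\<close>

lemma leading_defects_linear:
  assumes psi: "\<And>i. module_hom scale scale (psi i)"
  shows "module_bilinear scale (\<lambda>x y. fps_nth (bracket_defect psi x y) n)"
    and "module_hom scale scale (\<lambda>x. fps_nth (operator_defect psi x) n)"
proof -
  note S = series_at_linear[of psi, OF psi]
  have R: "module_hom (fps_scale scale) (fps_scale scale) (brt u)"
    and L: "module_hom (fps_scale scale) (fps_scale scale) (\<lambda>v. brt v u)" for u
    using def.bilinear_br by (simp_all add: module_bilinear_def)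
  note lin = module_hom.add[OF R] module_hom.scale[OF R] module_hom.add[OF L] module_hom.scale[OF L]
    module_hom.add[OF def.linear_K] module_hom.scale[OF def.linear_K]
  have mu: "module_hom scale scale (mu x)" "module_hom scale scale (\<lambda>y. mu y x)" for x
    using bilinear_br by (simp_all add: module_bilinear_def)
  note lin' = module_hom.add[OF mu(1)] module_hom.scale[OF mu(1)] module_hom.add[OF mu(2)]
    module_hom.scale[OF mu(2)] module_hom.add[OF linear_K] module_hom.scale[OF linear_K]
  show "module_bilinear scale (\<lambda>x y. fps_nth (bracket_defect psi x y) n)"
    unfolding module_bilinear_def module_hom_def module_hom_axioms_def bracket_defect_def
    by (simp add: module_scale S lin lin' fps_scale_const_nth[OF module_scale]
        scale_right_diff_distrib module_hom.add[OF psi] module_hom.scale[OF psi]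
        del: series_at_nth)
  show "module_hom scale scale (\<lambda>x. fps_nth (operator_defect psi x) n)"
    unfolding module_hom_def module_hom_axioms_def operator_defect_def
    by (simp add: module_scale S lin lin' fps_scale_const_nth[OF module_scale]
        scale_right_diff_distrib module_hom.add[OF psi] module_hom.scale[OF psi]
        del: series_at_nth)
qed

lemma leading_defects_cocycle:
  assumes psi: "intertwines_below n psi" and "n > 0"
  shows "((\<lambda>x y. fps_nth (bracket_defect psi x y) n), (\<lambda>x. fps_nth (operator_defect psi x) n))
    \<in> Z2_MLeib scale mu K lam"
proof -
  let ?S = "series_at psi" and ?D = "bracket_defect psi" and ?E = "operator_defect psi"
  define d where "d = (\<lambda>x y. fps_nth (?D x y) n)"
  define e where "e = (\<lambda>x. fps_nth (?E x) n)"
  have lin: "module_hom scale scale (psi i)" for i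
    using psi by (simp add: intertwines_below_def)
  have psi0: "psi 0 = id"
    using psi by (simp add: intertwines_below_def)
  have D: "brt (?S x) (?S y) = ?S (mu x y) + ?D x y" for x y
    by (simp add: bracket_defect_def)
  have E: "opt (?S x) = ?S (K x) + ?E x" for x
    by (simp add: operator_defect_def)
  have low: "vanishes_below n (?D x y)" "vanishes_below n (?E x)" for x y
    using psi by (simp_all add: intertwines_below_def)
  then have E0: "fps_nth (?E x) 0 = 0" for x
    using \<open>n > 0\<close> by (simp add: vanishes_below_def)
  note add = biadditiveD[OF biadditive_brt] additive.add[OF additive_opt]
  note add' = biadditiveD[OF biadditive_mu] additive.add[OF additive_K]
  note Slin = series_at_linear[of psi, OF lin]
  note lead = brt_leading[OF low(1) order_refl] brt_leading[OF low(2) order_refl]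
    opt_leading[OF low(1) order_refl]
  \<comment> \<open>Leading terms are taken twice: the inner bracket again vanishes below n, so
    \<open>opt\<close> acts on its coefficient n as K.\<close>
  have opt_brt: "fps_nth (opt (brt (?E x) (?S y))) n = K (mu (e x) y)"
    "fps_nth (opt (brt (?S y) (?E x))) n = K (mu y (e x))" for x y
  proof -
    have "vanishes_below n (brt (?E x) (?S y))" "vanishes_below n (brt (?S y) (?E x))"
      using low(2) unfolding vanishes_below_def
      by (auto simp: brt_leading[OF low(2)] add')
    then show "fps_nth (opt (brt (?E x) (?S y))) n = K (mu (e x) y)"
      "fps_nth (opt (brt (?S y) (?E x))) n = K (mu y (e x))"
      by (simp_all add: opt_leading lead psi0 e_def)
  qed
  have "delta2 mu d x y z = 0" for x y z
  proof -
    have "brt (?S x) (brt (?S y) (?S z))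
        = brt (brt (?S x) (?S y)) (?S z) + brt (?S y) (brt (?S x) (?S z))"
      by (rule def.left_leibniz)
    then have "?S (mu x (mu y z)) + ?D x (mu y z) + brt (?S x) (?D y z)
        = ?S (mu (mu x y) z) + ?D (mu x y) z + brt (?D x y) (?S z)
          + (?S (mu y (mu x z)) + ?D y (mu x z) + brt (?S y) (?D x z))"
      by (simp add: D add)
    \<comment> \<open>In degree n the \<open>?S\<close> terms cancel, being \<open>psi n\<close>
      applied to the Leibniz identity of g. With \<open>psi 0 = id\<close>, what remains is
      \<open>delta2 mu d x y z = 0\<close>.\<close>
    from arg_cong[OF this, of "\<lambda>v. fps_nth v n"] show ?thesis
      by (simp add: lead psi0 left_leibniz[of x y z] module_hom.add[OF lin] delta2_def
          flip: d_def) (simp add: algebra_simps d_def)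
  qed
  moreover have "partial1 mu K e x y + Phi2 scale K lam d x y = 0" for x y
  proof -
    have "brt (opt (?S x)) (opt (?S y)) = opt (brt (opt (?S x)) (?S y) + brt (?S x) (opt (?S y)))
        + fps_scale scale (fps_const lam) (brt (?S x) (?S y))"
      by (rule def.modified_rota_baxter)
    then have "?S (mu (K x) (K y)) + ?D (K x) (K y) + brt (?E x) (?S (K y)) + brt (?S (K x)) (?E y)
          + brt (?E x) (?E y)
        = ?S (K (mu (K x) y)) + ?E (mu (K x) y) + opt (?D (K x) y) + opt (brt (?E x) (?S y))
          + ?S (K (mu x (K y))) + ?E (mu x (K y)) + opt (?D x (K y)) + opt (brt (?S x) (?E y))
          + fps_scale scale (fps_const lam) (?S (mu x y) + ?D x y)"
      by (simp add: D E add algebra_simps)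
    \<comment> \<open>The product of two operator defects contributes nothing in degree n, as
      \<open>?E x\<close> has no constant term; this uses n > 0.\<close>
    from arg_cong[OF this, of "\<lambda>v. fps_nth v n"]
    have "psi n (mu (K x) (K y)) + d (K x) (K y) + mu (e x) (K y) + mu (K x) (e y)
        = psi n (K (mu (K x) y)) + e (mu (K x) y) + K (d (K x) y) + K (mu (e x) y)
          + psi n (K (mu x (K y))) + e (mu x (K y)) + K (d x (K y)) + K (mu x (e y))
          + (scale lam (psi n (mu x y)) + scale lam (d x y))"
      by (simp add: lead opt_brt psi0 E0 add' fps_scale_const_nth[OF module_scale]
          scale_right_distrib d_def e_def)
    \<comment> \<open>Applying \<open>psi n\<close> to the modified Rota-Baxter identity of g
      cancels all terms containing \<open>psi n\<close>.\<close>
    moreover have "psi n (mu (K x) (K y)) = psi n (K (mu (K x) y)) + psi n (K (mu x (K y)))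
        + scale lam (psi n (mu x y))"
      by (simp add: modified_rota_baxter add' module_hom.add[OF lin] module_hom.scale[OF lin])
    moreover have "e (mu (K x) y + mu x (K y)) = e (mu (K x) y) + e (mu x (K y))"
      using module_hom.add[OF leading_defects_linear(2)[of psi, OF lin]] by (simp add: e_def)
    ultimately show ?thesis
      by (simp add: partial1_def Phi2_def rhoL_K_def rhoR_K_def bracket_K_def add' algebra_simps)
  qed
  then have "- partial1 mu K e - Phi2 scale K lam d = 0"
    by (auto simp: fun_eq_iff intro: minus_unique)
  ultimately show ?thesis
    using leading_defects_linear[of psi n, OF lin]
    by (simp add: Z2_MLeib_def C2_MLeib_def d2_MLeib_def fun_eq_iff zero_prod_def d_def e_def)
qed

text \<open>Agreement below n makes the successive corrections stabilise in each
  coefficient.\<close>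

lemma intertwines_below_extend:
  assumes H2: "H2_MLeib scale mu K lam = {B2_MLeib scale mu K}"
    and psi: "intertwines_below n psi" and n: "n > 0"
  shows "\<exists>psi'. intertwines_below (Suc n) psi' \<and> (\<forall>m<n. psi' m = psi m)"
proof -
  let ?D = "bracket_defect psi" and ?E = "operator_defect psi"
  have lin: "module_hom scale scale (psi i)" for i
    using psi by (simp add: intertwines_below_def)
  \<comment> \<open>The cocycle equals \<open>d1_MLeib mu K (g, 0)\<close>; its second component is
    \<open>- Phi1 K g\<close>, hence the order of the two terms in e.\<close>
  obtain g where g: "module_hom scale scale g"
    and d: "\<And>x y. fps_nth (?D x y) n = mu x (g y) + mu (g x) y - g (mu x y)"
    and e: "\<And>x. fps_nth (?E x) n = K (g x) - g (K x)"
    using leading_defects_cocycle[OF psi n] Z2_MLeib_subset_B2_MLeib[OF H2]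
    by (fastforce simp: B2_MLeib_eq d1_MLeib_def delta1_def Phi1_def partial0_def rhoR_K_def
        biadditiveD[OF biadditive_mu] additive.zero[OF additive_K] fun_eq_iff)
  define psi' where "psi' = psi(n := \<lambda>x. psi n x - g x)"
  \<comment> \<open>\<open>T x\<close> is the series g(x) t^n, by which the new series at x differs
    from the old one.\<close>
  define T where "T = series_at (\<lambda>m. if m = n then g else (\<lambda>x. 0))"
  have T: "vanishes_below n (T x)" "fps_nth (T x) n = g x" for x
    by (simp_all add: T_def vanishes_below_def)
  have S: "series_at psi' x = series_at psi x - T x" for x
    by (simp add: fps_eq_iff psi'_def T_def)
  note b = biadditiveD[OF biadditive_brt] biadditiveD[OF biadditive_mu]
    additive.diff[OF additive_opt] additive.zero[OF additive_K]
  have psi0: "psi 0 = id"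
    using psi by (simp add: intertwines_below_def)
  have T0: "fps_nth (T x) 0 = 0" for x
    using T(1) n by (simp add: vanishes_below_def)
  have "bracket_defect psi' x y = ?D x y - brt (T x) (series_at psi y)
      - brt (series_at psi x) (T y) + brt (T x) (T y) + T (mu x y)" for x y
    by (simp add: bracket_defect_def S b)
  \<comment> \<open>In degree n the terms linear in T give minus \<open>delta1 mu g\<close>,
    cancelling d; the term quadratic in T drops out because \<open>T x\<close> has no constant
    term.\<close>
  then have "fps_nth (bracket_defect psi' x y) m = 0" if "m < Suc n" for x y m
    using that psi T(1) unfolding intertwines_below_def vanishes_below_def
    by (cases "m = n") (simp_all add: brt_leading[OF T(1)] d b psi0 T0 T(2))
  moreover have "operator_defect psi' x = ?E x - opt (T x) + T (K x)" for x
    by (simp add: operator_defect_def S b)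
  then have "fps_nth (operator_defect psi' x) m = 0" if "m < Suc n" for x m
    using that psi T(1) unfolding intertwines_below_def vanishes_below_def
    by (cases "m = n") (simp_all add: opt_leading[OF T(1)] e b T(2))
  moreover have "module_hom scale scale (psi' i)" for i
    using module_pair.module_hom_sub[OF module_pair.intro[OF module_scale module_scale] lin g] lin
    by (simp add: psi'_def)
  moreover have "psi' 0 = id"
    using psi0 n by (simp add: psi'_def)
  ultimately have "intertwines_below (Suc n) psi'"
    by (simp add: intertwines_below_def vanishes_below_def)
  then show ?thesis
    by (intro exI[of _ psi']) (simp add: psi'_def)
qed

lemma intertwines_all:
  assumes H2: "H2_MLeib scale mu K lam = {B2_MLeib scale mu K}"
  obtains psi where "psi 0 = id" "\<And>i. module_hom scale scale (psi i)"
    "\<And>x y. bracket_defect psi x y = 0" "\<And>x. operator_defect psi x = 0"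
proof -
  have "\<exists>f. \<forall>n. intertwines_below (Suc n) (f n) \<and> (\<forall>m<Suc n. f (Suc n) m = f n m)"
  proof (rule dependent_nat_choice)
    \<comment> \<open>The induction starts from the identity: its defects vanish in degree 0 because
      \<open>mut 0 = mu\<close> and \<open>Kt 0 = K\<close>.\<close>
    have "module_hom scale scale (constant_series id i)" for i
      by (simp add: constant_series_def module_hom_def module_hom_axioms_def module_scale)
    then show "\<exists>psi. intertwines_below (Suc 0) psi"
      by (intro exI[of _ "constant_series id"])
        (simp add: intertwines_below_def vanishes_below_def bracket_defect_def
          operator_defect_def fps_ext1_def fps_ext2_def constant_series_def)
  qed (use intertwines_below_extend[OF H2] in blast)
  then obtain f where f: "\<And>n. intertwines_below (Suc n) (f n)"
    and step: "\<And>n m. m \<le> n \<Longrightarrow> f (Suc n) m = f n m"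
    by (auto simp: less_Suc_eq_le)
  \<comment> \<open>Diagonal limit: coefficient m of \<open>f n\<close> no longer changes once n
    reaches m.\<close>
  define psi where "psi n = f n n" for n
  have prefix: "f n m = psi m" if "m \<le> n" for n m
    using that by (induction n rule: dec_induct) (simp_all add: psi_def step)
  have D: "fps_nth (bracket_defect psi x y) n = 0" for x y n
  proof -
    \<comment> \<open>Degree n of a bracket involves coefficients up to n only, where psi and
      \<open>f n\<close> agree.\<close>
    have "fps_nth (brt (series_at psi x) (series_at psi y)) n
        = fps_nth (brt (series_at (f n) x) (series_at (f n) y)) n"
      by (rule fps_ext2_cong) (simp_all add: prefix)
    then have "fps_nth (bracket_defect psi x y) n = fps_nth (bracket_defect (f n) x y) n"
      by (simp add: bracket_defect_def prefix)
    with f[of n] show ?thesis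
      by (simp add: intertwines_below_def vanishes_below_def)
  qed
  have E: "fps_nth (operator_defect psi x) n = 0" for x n
  proof -
    have "fps_nth (opt (series_at psi x)) n = fps_nth (opt (series_at (f n) x)) n"
      by (rule fps_ext1_cong) (simp add: prefix)
    then have "fps_nth (operator_defect psi x) n = fps_nth (operator_defect (f n) x) n"
      by (simp add: operator_defect_def prefix)
    with f[of n] show ?thesis
      by (simp add: intertwines_below_def vanishes_below_def)
  qed
  show thesis
    by (rule that[of psi])
      (use f in \<open>simp_all add: psi_def intertwines_below_def fps_eq_iff D E\<close>)
qed

text \<open>Both sides of each intertwining relation are additive and commute with multiplication by
  t in every argument, so equality on constants, which is the vanishing of the defects,
  suffices.\<close>

lemma intertwines_imp_trivial:
  assumes psi0: "psi 0 = id" and lin: "\<And>i. module_hom scale scale (psi i)"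
    and D: "\<And>x y. bracket_defect psi x y = 0" and E: "\<And>x. operator_defect psi x = 0"
  shows "trivial_deformation scale mu K mut Kt"
proof -
  let ?P = "fps_ext1 psi" and ?mu = "fps_ext2 (constant_series mu)"
    and ?K = "fps_ext1 (constant_series K)"
  have psi: "additive (psi i)" for i
    using lin by (rule module_hom_imp_additive)
  have cmu: "biadditive (constant_series mu i)" for i
    using biadditive_mu by (simp add: constant_series_def biadditive_def additive_def)
  have cK: "additive (constant_series K i)" for i
    using additive_K by (simp add: constant_series_def additive_def)
  have P_const: "?P (fps_const x) = series_at psi x" for x
    by (simp add: fps_ext1_const[of psi, OF psi] series_at_def)
  have K_const: "?K (fps_const x) = fps_const (K x)" for x
    by (auto simp: fps_ext1_const[of "constant_series K", OF cK] fps_eq_iff constant_series_def)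
  note P = additive_fps_ext1[of psi, OF psi]
  note mu = biadditive_fps_ext2[of "constant_series mu", OF cmu]
  note K = additive_fps_ext1[of "constant_series K", OF cK]
  note add = additive.add[OF P] biadditiveD[OF mu] biadditiveD[OF biadditive_brt]
    additive.add[OF K] additive.add[OF additive_opt]
  note shift = fps_ext1_shift_up[of psi, OF psi] fps_ext2_shift_up[of "constant_series mu", OF cmu]
    fps_ext2_shift_up[of mut, OF biadditive_mut] fps_ext1_shift_up[of "constant_series K", OF cK]
    fps_ext1_shift_up[of Kt, OF additive_Kt]
  have shift_diff: "shift_up v - shift_up w = shift_up (v - w)" for v w :: "'g fps"
    by (simp add: fps_eq_iff shift_up_def split: nat.split)
  \<comment> \<open>The two arguments of the bracket are freed one at a time: first w with v
    constant, then v.\<close>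
  have const: "?P (?mu (fps_const x) w) - brt (?P (fps_const x)) (?P w) = 0" for x w
    by (rule additive_shift_up_eq_zero[where v = w])
      (use D in \<open>simp_all add: additive_def add shift shift_diff P_const bracket_defect_def
        fps_ext2_constant_series_const[OF biadditive_mu]\<close>)
  have "?P (?mu v w) - brt (?P v) (?P w) = 0" for v w
    by (rule additive_shift_up_eq_zero[where v = v])
      (use const in \<open>simp_all add: additive_def add shift shift_diff\<close>)
  moreover have "?P (?K v) - opt (?P v) = 0" for v
    by (rule additive_shift_up_eq_zero[where v = v])
      (use E in \<open>simp_all add: additive_def add shift shift_diff P_const K_const
        operator_defect_def\<close>)
  ultimately show ?thesis
    unfolding trivial_deformation_def equivalent_deformations_def
    using psi0 lin bij_fps_ext1[of psi] by (intro exI[of _ psi]) auto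
qed

end

theorem theorem4p7:
  fixes scale :: "'k::field_char_0 \<Rightarrow> 'g::ab_group_add \<Rightarrow> 'g"
    and mu :: "'g \<Rightarrow> 'g \<Rightarrow> 'g" and K :: "'g \<Rightarrow> 'g" and lam :: 'k
  assumes "modified_rota_baxter_leibniz_algebra scale mu K lam"
    and "H2_MLeib scale mu K lam = {B2_MLeib scale mu K}"
  shows "rigid scale mu K lam"
  unfolding rigid_def
proof (intro allI impI)
  fix mut Kt
  assume "formal_deformation scale mu K lam mut Kt"
  then interpret deformed_algebra scale mu K lam mut Kt
    using assms(1) by (simp add: deformed_algebra_def deformed_algebra_axioms_def)
  show "trivial_deformation scale mu K mut Kt"
    using intertwines_all[OF assms(2)] intertwines_imp_trivial by metis
qed

end
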